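(* A finite abelian group $G$ is minimally faithful of degree $n$ if and only if it is an elementary abelian $p$-group of rank $n$ (that is, $G\cong (C_p)^n$) for some prime $p$.
   Context: For a finite group $G$, $\operatorname{rdim}(G)$ denotes the smallest dimension of a faithful complex linear representation of $G$ (the trivial group has representation dimension $0$). A finite group $G$ is called minimally faithful of degree $n$ if $\operatorname{rdim}(G)=n$ and $\operatorname{rdim}(H)<n$ for every proper subgroup $H$ of $G$. $C_p$ is the cyclic group of order $p$. *)

theory Defs
  imports
    "HOL-Algebra.Elementary_Groups"
    "HOL-Algebra.Product_Groups"
    "HOL-Computational_Algebra.Primes"
    "Jordan_Normal_Form.Matrix"
begin

definition GL_complex :: "nat \<Rightarrow> complex mat monoid" where
  "GL_complex d = units_of (ring_mat TYPE(complex) d ())"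

(* A complex linear representation of dimension d is a group homomorphism into GL_d(C); it is
   faithful iff it is injective, that is, a monomorphism.  Dimension 0 is allowed: GL_0(C) is the
   trivial group.  For a finite group the set below is nonempty (regular representation), so LEAST
   is the genuine minimum; the definition is only meant for finite groups. *)
definition rdim :: "('a, 'b) monoid_scheme \<Rightarrow> nat" where
  "rdim G = (LEAST d. mon G (GL_complex d) \<noteq> {})"

definition minimally_faithful :: "('a, 'b) monoid_scheme \<Rightarrow> nat \<Rightarrow> bool" where
  "minimally_faithful G n \<longleftrightarrow>
     rdim G = n \<and> (\<forall>H. subgroup H G \<and> H \<subset> carrier G \<longrightarrow> rdim (G\<lparr>carrier := H\<rparr>) < n)"

definition elementary_abelian :: "('a, 'b) monoid_scheme \<Rightarrow> nat \<Rightarrow> nat \<Rightarrow> bool" where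
  "elementary_abelian G p n \<longleftrightarrow> G \<cong> product_group {..<n} (\<lambda>_. integer_mod_group p)"

end

theory Submission
  imports
    Defs
    "HOL-Algebra.Multiplicative_Group"
    "HOL-Algebra.Sylow"
    "Jordan_Normal_Form.VS_Connect"
begin

text \<open>
  The representation dimension of a finite abelian group \<open>G\<close> is the largest of its \<open>p\<close>-ranks. It is used in the form of
  two estimates, in which the \<open>p\<close>-rank enters through the order of the \<open>p\<close>-torsion.

  Upper bound (\<open>rdim_le\<close>): if the \<open>p\<close>-torsion has at most \<open>p ^ d\<close> elements for every prime \<open>p\<close>, then \<open>G\<close> has a faithful
  representation of dimension \<open>d\<close>. Indeed \<open>d\<close> characters with trivial common kernel give a faithful diagonal
  representation. They are found one at a time: an element \<open>x\<close> of maximal order has a power of order \<open>p\<close> for every prime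
  \<open>p\<close> dividing the order of the group, and a character that is faithful on the powers of \<open>x\<close> is therefore nontrivial on
  the \<open>p\<close>-torsion for all these \<open>p\<close> together. Its kernel has \<open>p\<close>-torsion smaller by a factor \<open>p\<close>, and one
  continues with the kernel (\<open>ex_characters_trivial_common_kernel\<close>). The characters exist on all of \<open>G\<close> because characters
  extend from subgroups (\<open>character_extend\<close>).

  Lower bound (\<open>card_torsion_le_rdim\<close>): the \<open>p\<close>-torsion has at most \<open>p ^ rdim G\<close> elements. Simultaneous eigenvectors are
  peeled off one by one; each new one is linearly independent of the earlier ones, and its stabiliser has index at most \<open>p\<close>
  (\<open>card_subgroup_le_of_fixed_vectors\<close>).

  Consequently a finite abelian group of exponent dividing \<open>p\<close> and order \<open>p ^ k\<close> has representation dimension \<open>k\<close>, and so proper subgroups of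
  elementary abelian groups have smaller dimension. Conversely, some prime \<open>p\<close> attains the maximal rank, and then the
  \<open>p\<close>-torsion has the same representation dimension as \<open>G\<close>; minimality makes it equal to \<open>G\<close>, so that the exponent
  of \<open>G\<close> divides \<open>p\<close>. That a group of exponent dividing \<open>p\<close> is a power of the cyclic group of order \<open>p\<close> follows from the separating characters again, by
  counting.
\<close>

section \<open>Characters and their extension\<close>

text \<open>
  A character of the subgroup \<open>H\<close> is kept as a function on the whole type, so that restricting it to a
  smaller subgroup needs no new function. Values in the nonzero complex numbers are a consequence
  (\<open>character_nonzero\<close>), because \<open>\<one>\<close> is sent to \<open>1\<close>.
\<close>

definition character :: "('a, 'b) monoid_scheme \<Rightarrow> 'a set \<Rightarrow> ('a \<Rightarrow> complex) \<Rightarrow> bool" where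
  "character G H \<chi> \<longleftrightarrow>
     \<chi> \<one>\<^bsub>G\<^esub> = 1 \<and> (\<forall>x\<in>H. \<forall>y\<in>H. \<chi> (x \<otimes>\<^bsub>G\<^esub> y) = \<chi> x * \<chi> y)"

lemma character_one: "character G H \<chi> \<Longrightarrow> \<chi> \<one>\<^bsub>G\<^esub> = 1"
  by (simp add: character_def)

lemma character_mult:
  "character G H \<chi> \<Longrightarrow> x \<in> H \<Longrightarrow> y \<in> H \<Longrightarrow> \<chi> (x \<otimes>\<^bsub>G\<^esub> y) = \<chi> x * \<chi> y"
  by (simp add: character_def)

lemma character_subset: "character G H \<chi> \<Longrightarrow> K \<subseteq> H \<Longrightarrow> character G K \<chi>"
  by (auto simp: character_def)

context group
begin

lemma subgroup_nat_pow_closed: "subgroup H G \<Longrightarrow> x \<in> H \<Longrightarrow> x [^] (k::nat) \<in> H"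
  by (induction k) (auto simp: subgroup.one_closed subgroup.m_closed)

lemma character_pow:
  assumes "subgroup H G" "character G H \<chi>" "x \<in> H"
  shows "\<chi> (x [^] (k::nat)) = \<chi> x ^ k"
  using assms
  by (induction k) (auto simp: character_one character_mult subgroup_nat_pow_closed)

lemma character_nonzero:
  assumes "subgroup H G" "character G H \<chi>" "x \<in> H"
  shows "\<chi> x \<noteq> 0"
proof
  assume "\<chi> x = 0"
  then have "\<chi> (x \<otimes> inv x) = 0"
    using assms by (simp only: character_mult subgroup.m_inv_closed) simp
  then show False
    using assms by (simp add: character_one subgroup.mem_carrier)
qed

lemma character_inv:
  assumes "subgroup H G" "character G H \<chi>" "x \<in> H"
  shows "\<chi> (inv x) = inverse (\<chi> x)"
proof -
  have "\<chi> x * \<chi> (inv x) = \<chi> (x \<otimes> inv x)"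
    using assms by (simp only: character_mult subgroup.m_inv_closed)
  also have "\<dots> = 1"
    using assms by (simp add: character_one subgroup.mem_carrier)
  finally show ?thesis
    by (metis inverse_unique)
qed

lemma character_kernel_subgroup:
  assumes "subgroup H G" "character G H \<chi>"
  shows "subgroup {x \<in> H. \<chi> x = 1} G"
proof (rule subgroupI)
  have "\<one> \<in> {x \<in> H. \<chi> x = 1}"
    using assms by (simp add: subgroup.one_closed character_one)
  then show "{x \<in> H. \<chi> x = 1} \<noteq> {}" by blast
qed (use assms in \<open>auto simp: subgroup.mem_carrier subgroup.m_closed subgroup.m_inv_closed
        character_mult character_inv\<close>)

lemma character_eq_iff:
  assumes "subgroup H G" "character G H \<chi>" "x \<in> H" "y \<in> H"
  shows "\<chi> x = \<chi> y \<longleftrightarrow> \<chi> (x \<otimes> inv y) = 1"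
  using assms character_nonzero[OF assms(1,2,4)]
  by (simp add: character_mult subgroup.m_inv_closed character_inv field_simps)

text \<open>
  In a finite group inverses are powers, so closure under multiplication suffices.
\<close>

lemma finite_subgroupI:
  assumes "finite (carrier G)" "H \<subseteq> carrier G" "\<one> \<in> H"
    and closed: "\<And>x y. x \<in> H \<Longrightarrow> y \<in> H \<Longrightarrow> x \<otimes> y \<in> H"
  shows "subgroup H G"
proof (rule subgroupI)
  fix x assume x: "x \<in> H"
  then have xG: "x \<in> carrier G" using assms by auto
  have "x [^] k \<in> H" for k :: nat
    by (induction k) (use x assms in auto)
  moreover have "inv x = x [^] (ord x - 1)"
  proof (rule inv_equality)
    have "x [^] (ord x - 1) \<otimes> x = x [^] (Suc (ord x - 1))" by simp
    also have "Suc (ord x - 1) = ord x"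
      using ord_ge_1[OF assms(1) xG] by simp
    finally show "x [^] (ord x - 1) \<otimes> x = \<one>"
      using xG by simp
  qed (use xG in auto)
  ultimately show "inv x \<in> H" by simp
qed (use assms in auto)

end

context comm_group
begin

text \<open>
  The value \<open>z\<close> at the new element may be prescribed freely, provided that it agrees with \<open>\<chi>\<close> on those
  powers of \<open>g\<close> that already lie in \<open>H\<close>. Every element of the enlarged subgroup is \<open>h \<otimes> g [^] i\<close>; two such
  expressions of the same element differ by a power of \<open>g\<close> in \<open>H\<close>, which is why
  \<open>\<chi> h * z ^ i\<close> depends on the element only.
\<close>

lemma character_extend_by_element:
  assumes H: "subgroup H G" and fin: "finite (carrier G)" and \<chi>: "character G H \<chi>"
    and g: "g \<in> carrier G"
    and z: "\<And>k::nat. g [^] k \<in> H \<Longrightarrow> z ^ k = \<chi> (g [^] k)"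
  obtains H' \<psi> where "subgroup H' G" "H \<subseteq> H'" "g \<in> H'" "character G H' \<psi>"
    "\<And>x. x \<in> H \<Longrightarrow> \<psi> x = \<chi> x" "\<psi> g = z"
proof -
  define H' where "H' = {x. \<exists>h i. h \<in> H \<and> x = h \<otimes> g [^] (i::nat)}"
  define \<psi> where "\<psi> x = (THE c. \<exists>h i. h \<in> H \<and> x = h \<otimes> g [^] (i::nat) \<and> c = \<chi> h * z ^ i)" for x
  have HG: "h \<in> carrier G" if "h \<in> H" for h
    using that H by (rule subgroup.mem_carrier[rotated])
  \<comment> \<open>With the exponents in order there is no division by \<open>z\<close>.\<close>
  have unique_le: "\<chi> h * z ^ i = \<chi> h' * z ^ j"
    if "h \<in> H" "h' \<in> H" "h \<otimes> g [^] i = h' \<otimes> g [^] j" "i \<le> j" for h h' and i j :: nat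
  proof -
    have "h' \<otimes> g [^] (j - i) \<otimes> g [^] i = h' \<otimes> g [^] j"
      using that g HG by (simp add: m_assoc nat_pow_mult)
    also have "\<dots> = h \<otimes> g [^] i" using that by simp
    finally have eq: "h' \<otimes> g [^] (j - i) = h"
      using that g HG by (metis m_closed nat_pow_closed right_cancel)
    then have "g [^] (j - i) = inv h' \<otimes> h"
      using that g HG by (metis inv_solve_left m_closed nat_pow_closed)
    then have mem: "g [^] (j - i) \<in> H"
      using that H by (simp add: subgroup.m_closed subgroup.m_inv_closed)
    have "\<chi> h = \<chi> h' * z ^ (j - i)"
      using z[OF mem] character_mult[OF \<chi> that(2) mem] eq by simp
    then show ?thesis
      using that by (simp flip: power_add)
  qed
  have unique: "\<chi> h * z ^ i = \<chi> h' * z ^ j"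
    if "h \<in> H" "h' \<in> H" "h \<otimes> g [^] i = h' \<otimes> g [^] j" for h h' and i j :: nat
    using unique_le[of h h' i j] unique_le[of h' h j i] that by (metis nle_le)
  have \<psi>: "\<psi> (h \<otimes> g [^] i) = \<chi> h * z ^ i" if "h \<in> H" for h and i :: nat
    unfolding \<psi>_def
  proof (rule the_equality)
    fix c assume "\<exists>h' j. h' \<in> H \<and> h \<otimes> g [^] i = h' \<otimes> g [^] (j::nat) \<and> c = \<chi> h' * z ^ j"
    then show "c = \<chi> h * z ^ i" using that unique by metis
  qed (use that in blast)
  have one: "\<one> \<in> H" using H by (rule subgroup.one_closed)
  have mult: "h \<otimes> g [^] i \<otimes> (h' \<otimes> g [^] j) = h \<otimes> h' \<otimes> g [^] (i + j)"
    if "h \<in> H" "h' \<in> H" for h h' and i j :: nat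
    using that g HG by (simp add: m_ac flip: nat_pow_mult)
  have sub: "H \<subseteq> H'"
  proof
    fix h assume "h \<in> H"
    then show "h \<in> H'" unfolding H'_def using HG by (intro CollectI exI[of _ h] exI[of _ 0]) auto
  qed
  have gH': "g \<in> H'" unfolding H'_def
    using one g by (intro CollectI exI[of _ \<one>] exI[of _ 1]) auto
  have "subgroup H' G"
  proof (rule finite_subgroupI[OF fin])
    show "H' \<subseteq> carrier G" using g HG by (auto simp: H'_def)
    show "\<one> \<in> H'" using sub one by auto
    fix x y assume "x \<in> H'" "y \<in> H'"
    then show "x \<otimes> y \<in> H'"
      unfolding H'_def using mult H by (auto intro: subgroup.m_closed) (metis subgroup.m_closed)
  qed
  moreover have \<psi>H: "\<psi> x = \<chi> x" if "x \<in> H" for x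
    using \<psi>[of x 0] that HG by simp
  moreover have "character G H' \<psi>"
    unfolding character_def
  proof (intro conjI ballI)
    show "\<psi> \<one> = 1" using \<psi>H one \<chi> by (simp add: character_one)
    fix x y assume "x \<in> H'" "y \<in> H'"
    then obtain h i h' j where *: "h \<in> H" "h' \<in> H" "x = h \<otimes> g [^] (i::nat)" "y = h' \<otimes> g [^] (j::nat)"
      unfolding H'_def by auto
    then show "\<psi> (x \<otimes> y) = \<psi> x * \<psi> y"
      using \<psi>[of h i] \<psi>[of h' j] \<psi>[of "h \<otimes> h'" "i + j"] H
      by (simp add: mult character_mult[OF \<chi>] subgroup.m_closed power_add)
  qed
  moreover have "\<psi> g = z"
    using \<psi>[OF one, of 1] g \<chi> by (simp add: character_one)
  ultimately show thesis
    using that sub gH' by blast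
qed

text \<open>
  The multiplicative group of the complex numbers is divisible. If \<open>k\<close> is the order of \<open>g\<close> modulo \<open>H\<close>, any
  \<open>k\<close>-th root of the value at \<open>g [^] k\<close> is an admissible value at \<open>g\<close>, so a character can be extended one
  element at a time.
\<close>

lemma character_extend:
  assumes "subgroup H G" and fin: "finite (carrier G)" and "character G H \<chi>"
  obtains \<psi> where "character G (carrier G) \<psi>" "\<And>x. x \<in> H \<Longrightarrow> \<psi> x = \<chi> x"
proof -
  have "\<exists>\<psi>. character G (carrier G) \<psi> \<and> (\<forall>x\<in>H. \<psi> x = \<chi> x)"
    using assms(1,3)
  proof (induction "card (carrier G - H)" arbitrary: H \<chi> rule: less_induct)
    case less
    note H = less.prems(1) and \<chi> = less.prems(2)
    show ?case
    proof (cases "H = carrier G")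
      case True
      with \<chi> show ?thesis by auto
    next
      case False
      then obtain g where g: "g \<in> carrier G" "g \<notin> H"
        using subgroup.subset[OF H] by auto
      define k where "k = (LEAST k. 0 < k \<and> g [^] (k::nat) \<in> H)"
      have "0 < ord g \<and> g [^] ord g \<in> H"
        using g H fin ord_ge_1[OF fin g(1)] by (simp add: subgroup.one_closed)
      then have k: "0 < k \<and> g [^] k \<in> H"
        unfolding k_def by (rule LeastI)
      have k_le: "k \<le> m" if "0 < m" "g [^] m \<in> H" for m
        unfolding k_def using that by (intro Least_le) auto
      obtain z where zk: "z ^ k = \<chi> (g [^] k)"
      proof
        show "rcis (root k (cmod (\<chi> (g [^] k)))) (Arg (\<chi> (g [^] k)) / k) ^ k = \<chi> (g [^] k)"
          using k by (simp add: DeMoivre2 rcis_cmod_Arg)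
      qed
      have z: "z ^ m = \<chi> (g [^] m)" if m: "g [^] m \<in> H" for m :: nat
      proof -
        define q where "q = m div k"
        define r where "r = m mod k"
        have mqr: "m = k * q + r" by (simp add: q_def r_def)
        have q: "(g [^] k) [^] q \<in> H" using k H by (simp add: subgroup_nat_pow_closed)
        have "g [^] m = (g [^] k) [^] q \<otimes> g [^] r"
          using g by (simp add: mqr nat_pow_mult nat_pow_pow)
        then have "g [^] r = inv ((g [^] k) [^] q) \<otimes> g [^] m"
          using g by (metis inv_solve_left nat_pow_closed)
        then have "g [^] r \<in> H"
          using m q H by (simp add: subgroup.m_closed subgroup.m_inv_closed)
        moreover have "r < k" using k by (simp add: r_def)
        ultimately have "r = 0" using k_le[of r] by fastforce
        then show ?thesis
          using character_pow[OF H \<chi>, of "g [^] k" q] k g zk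
          by (simp add: mqr power_mult nat_pow_pow)
      qed
      obtain H' \<psi> where H': "subgroup H' G" "H \<subseteq> H'" "g \<in> H'" "character G H' \<psi>"
          "\<And>x. x \<in> H \<Longrightarrow> \<psi> x = \<chi> x"
        using character_extend_by_element[OF H fin \<chi> g(1) z] by metis
      have "card (carrier G - H') < card (carrier G - H)"
        using H' g fin by (intro psubset_card_mono) auto
      from less.hyps[OF this H'(1,4)] H'(2,5) show ?thesis
        by (metis subsetD)
    qed
  qed
  then show thesis using that by auto
qed

end

section \<open>Torsion and separating characters\<close>

text \<open>
  The \<open>p\<close>-torsion is only ever measured by its cardinality. For a prime \<open>p\<close> the bound
  \<open>card (torsion G H p) \<le> p ^ d\<close> says that the \<open>p\<close>-rank of \<open>H\<close> is at most \<open>d\<close>, which spares vector spaces over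
  finite fields.
\<close>

definition torsion :: "('a, 'b) monoid_scheme \<Rightarrow> 'a set \<Rightarrow> nat \<Rightarrow> 'a set" where
  "torsion G H p = {x \<in> H. x [^]\<^bsub>G\<^esub> p = \<one>\<^bsub>G\<^esub>}"

lemma coprime_powers_eq_1:
  fixes z :: "'a :: monoid_mult"
  assumes "z ^ a = 1" "z ^ b = 1" "coprime a b" "a \<noteq> 0"
  shows "z = 1"
proof -
  obtain x y where "a * x = b * y + 1"
    using bezout_nat[of a b] assms by auto
  then have "z ^ (a * x) = z ^ (b * y) * z"
    by (simp only: power_add power_one_right)
  then show ?thesis
    using assms by (simp add: power_mult)
qed

lemma power_mod_eq_if_power_eq_1:
  fixes z :: "'a :: monoid_mult"
  assumes "z ^ n = 1"
  shows "z ^ (k mod n) = z ^ k"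
proof -
  have "z ^ k = (z ^ n) ^ (k div n) * z ^ (k mod n)"
    by (simp flip: power_mult power_add)
  then show ?thesis using assms by simp
qed

lemma bij_betw_powers_roots_unity:
  assumes "0 < n"
  shows "bij_betw (\<lambda>k. cis (2 * pi / real n) ^ k) {..<n} {z. z ^ n = 1}"
proof -
  have "cis (2 * pi / real n) ^ k = cis (2 * pi * real k / real n)" for k
    by (simp add: DeMoivre mult_ac)
  then show ?thesis using bij_betw_roots_unity[OF assms] by simp
qed

lemma cis_power_eq_1_iff:
  assumes "0 < n"
  shows "cis (2 * pi / real n) ^ k = 1 \<longleftrightarrow> n dvd k"
proof -
  let ?z = "cis (2 * pi / real n)"
  have "?z ^ n = 1" using assms by (simp add: DeMoivre)
  then have "?z ^ k = 1 \<longleftrightarrow> ?z ^ (k mod n) = ?z ^ 0"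
    by (simp add: power_mod_eq_if_power_eq_1)
  also have "\<dots> \<longleftrightarrow> k mod n = 0"
    using bij_betw_powers_roots_unity[OF assms] assms
    by (intro inj_on_eq_iff[of "\<lambda>k. ?z ^ k" "{..<n}"]) (auto simp: bij_betw_def)
  finally show ?thesis by auto
qed

lemma inj_on_powers_root_of_unity:
  fixes z :: complex
  assumes "prime p" "z ^ p = 1" "z \<noteq> 1"
  shows "inj_on (\<lambda>i. z ^ i) {..<p}"
proof (rule linorder_inj_onI)
  fix i j assume ij: "i < j" "i \<in> {..<p}" "j \<in> {..<p}"
  show "z ^ i \<noteq> z ^ j"
  proof
    assume "z ^ i = z ^ j"
    moreover have "z ^ j = z ^ i * z ^ (j - i)"
      using ij by (simp flip: power_add)
    moreover have "z \<noteq> 0"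
      using assms prime_gt_0_nat[OF assms(1)] by (auto simp: zero_power)
    ultimately have "z ^ (j - i) = 1" by simp
    moreover have "coprime (j - i) p"
      using ij assms(1) by (intro coprime_commute[THEN iffD1, OF prime_imp_coprime])
        (use ij assms(1) dvd_imp_le[of p "j - i"] in auto)
    ultimately have "z = 1"
      using ij assms(2) by (intro coprime_powers_eq_1[of z "j - i" p]) auto
    with assms show False by simp
  qed
qed auto

context group
begin

text \<open>
  Cauchy's theorem, from the Sylow subgroup theorem with exponent one.
\<close>

lemma cauchy:
  assumes H: "subgroup H G" and fin: "finite H" and p: "prime p" "p dvd card H"
  obtains x where "x \<in> torsion G H p" "x \<noteq> \<one>"
proof -
  interpret H: group "G\<lparr>carrier := H\<rparr>"
    using H by (rule subgroup_imp_group)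
  obtain m where m: "card H = p * m" using p(2) by auto
  obtain K where K: "subgroup K (G\<lparr>carrier := H\<rparr>)" "card K = p"
    using sylow_thm[OF p(1) H.group_axioms, of 1 m] m fin by (auto simp: Coset.order_def)
  have KH: "K \<subseteq> H" and KG: "subgroup K G"
    using subgroup.subset[OF K(1)] incl_subgroup[OF H K(1)] by auto
  have finK: "finite K" using KH fin finite_subset by blast
  have one: "\<one> \<in> K" using KG by (rule subgroup.one_closed)
  have "card (K - {\<one>}) > 0"
    using one K(2) prime_gt_1_nat[OF p(1)] finK by simp
  then obtain x where x: "x \<in> K" "x \<noteq> \<one>"
    by (metis Diff_iff all_not_in_conv card.empty insertI1 less_irrefl)
  interpret K: group "G\<lparr>carrier := K\<rparr>"
    using KG by (rule subgroup_imp_group)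
  have "x [^]\<^bsub>G\<lparr>carrier := K\<rparr>\<^esub> Coset.order (G\<lparr>carrier := K\<rparr>) = \<one>"
    using K.pow_order_eq_1[of x] x by simp
  then have "x [^] p = \<one>"
    using K(2) by (simp add: Coset.order_def flip: nat_pow_consistent)
  then show thesis using that x KH by (auto simp: torsion_def)
qed

lemma trivial_if_no_torsion:
  assumes H: "subgroup H G" and fin: "finite H" and "\<And>p. prime p \<Longrightarrow> card (torsion G H p) \<le> 1"
  shows "H = {\<one>}"
proof (rule ccontr)
  assume "H \<noteq> {\<one>}"
  then have "card H \<noteq> 1"
    using subgroup.one_closed[OF H] by (auto simp: card_1_singleton_iff)
  then obtain p where p: "prime p" "p dvd card H"
    using prime_factor_nat by blast
  obtain x where x: "x \<in> torsion G H p" "x \<noteq> \<one>"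
    using cauchy[OF H fin p] .
  have "{\<one>, x} \<subseteq> torsion G H p"
    using x H by (auto simp: torsion_def subgroup.one_closed)
  moreover have "finite (torsion G H p)" using fin by (simp add: torsion_def)
  ultimately have "card {\<one>, x} \<le> card (torsion G H p)" by (intro card_mono)
  also have "\<dots> \<le> 1" using assms p by simp
  finally show False using x by simp
qed

text \<open>
  The nonempty fibres of \<open>\<chi>\<close> are cosets of its kernel.
\<close>

lemma card_eq_card_kernel_times_card_image:
  assumes H: "subgroup H G" and fin: "finite H" and \<chi>: "character G H \<chi>"
  shows "card H = card {x \<in> H. \<chi> x = 1} * card (\<chi> ` H)"
proof -
  let ?K = "{x \<in> H. \<chi> x = 1}"
  have fibre: "card {x \<in> H. \<chi> x = c} = card ?K" if "c \<in> \<chi> ` H" for c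
  proof -
    from that obtain y where y: "y \<in> H" "c = \<chi> y" by auto
    have HG: "H \<subseteq> carrier G" using H by (rule subgroup.subset)
    have "bij_betw (\<lambda>x. x \<otimes> y) ?K {x \<in> H. \<chi> x = c}"
    proof (rule bij_betw_byWitness[where f' = "\<lambda>x. x \<otimes> inv y"])
      show "\<forall>a\<in>?K. a \<otimes> y \<otimes> inv y = a" "\<forall>a\<in>{x \<in> H. \<chi> x = c}. a \<otimes> inv y \<otimes> y = a"
        using y HG by (auto simp: m_assoc subset_iff)
      show "(\<lambda>x. x \<otimes> y) ` ?K \<subseteq> {x \<in> H. \<chi> x = c}"
        using y H by (auto simp: subgroup.m_closed character_mult[OF \<chi>])
      show "(\<lambda>x. x \<otimes> inv y) ` {x \<in> H. \<chi> x = c} \<subseteq> ?K"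
        using y H character_eq_iff[OF H \<chi>]
        by (auto simp: subgroup.m_closed subgroup.m_inv_closed)
    qed
    then show ?thesis by (simp add: bij_betw_same_card)
  qed
  have "card H = (\<Sum>c\<in>\<chi> ` H. \<Sum>x\<in>{x \<in> H. \<chi> x = c}. 1)"
    using sum.image_gen[OF fin, of "\<lambda>_. 1 :: nat" \<chi>] by simp
  also have "\<dots> = (\<Sum>c\<in>\<chi> ` H. card ?K)"
    by (intro sum.cong) (simp_all add: fibre)
  finally show ?thesis by simp
qed

end

context comm_group
begin

lemma torsion_subgroup:
  assumes H: "subgroup H G"
  shows "subgroup (torsion G H p) G"
proof (rule subgroupI)
  have "\<one> \<in> torsion G H p" using H by (simp add: torsion_def subgroup.one_closed)
  then show "torsion G H p \<noteq> {}" by blast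
qed (use H in \<open>auto simp: torsion_def subgroup.mem_carrier subgroup.m_closed subgroup.m_inv_closed
       nat_pow_distrib nat_pow_inv\<close>)

text \<open>
  Passing to the kernel of a character that is nontrivial on the \<open>p\<close>-torsion lowers the \<open>p\<close>-rank: the image of
  the \<open>p\<close>-torsion contains all powers of a nontrivial \<open>p\<close>-th root of unity, hence at least \<open>p\<close> values.
\<close>

lemma prime_times_card_torsion_kernel_le:
  assumes H: "subgroup H G" and fin: "finite H" and \<chi>: "character G H \<chi>" and p: "prime p"
    and y: "y \<in> torsion G H p" "\<chi> y \<noteq> 1"
  shows "p * card (torsion G {x \<in> H. \<chi> x = 1} p) \<le> card (torsion G H p)"
proof -
  let ?T = "torsion G H p"
  have T: "subgroup ?T G" "finite ?T" "?T \<subseteq> H"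
    using torsion_subgroup[OF H] fin by (auto simp: torsion_def)
  have \<chi>T: "character G ?T \<chi>" using \<chi> T(3) by (rule character_subset)
  have pow: "\<chi> (y [^] k) = \<chi> y ^ k" for k :: nat
    using character_pow[OF T(1) \<chi>T y(1)] .
  have "\<chi> y ^ p = 1"
    using pow[of p] y(1) \<chi> by (simp add: torsion_def character_one)
  then have "card ((\<lambda>i. \<chi> y ^ i) ` {..<p}) = p"
    using inj_on_powers_root_of_unity[OF p _ y(2)] by (simp add: card_image)
  moreover have "(\<lambda>i. \<chi> y ^ i) ` {..<p} \<subseteq> \<chi> ` ?T"
    using subgroup_nat_pow_closed[OF T(1) y(1)] by (auto simp flip: pow)
  ultimately have "p \<le> card (\<chi> ` ?T)"
    using T(2) card_mono[of "\<chi> ` ?T" "(\<lambda>i. \<chi> y ^ i) ` {..<p}"] by auto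
  moreover have "{x \<in> ?T. \<chi> x = 1} = torsion G {x \<in> H. \<chi> x = 1} p"
    by (auto simp: torsion_def)
  ultimately show ?thesis
    using card_eq_card_kernel_times_card_image[OF T(1,2) \<chi>T] by (simp add: mult.commute)
qed

text \<open>
  Multiplying by an element of prime order \<open>p\<close> raises the order of \<open>x\<close> unless \<open>p\<close> divides it
  already, so the order of an element of maximal order is divisible by every prime that is the order of some element.
\<close>

lemma ord_mult_prime:
  assumes x: "x \<in> carrier G" and y: "y \<in> carrier G" "y \<noteq> \<one>" "y [^] p = \<one>"
    and p: "prime p" "\<not> p dvd ord x"
  shows "p * ord x dvd ord (x \<otimes> y)"
proof -
  let ?k = "ord (x \<otimes> y)"
  have ordy: "ord y = p"
    using y p pow_eq_id[of y p] ord_eq_1[of y] by (metis prime_nat_iff)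
  have k: "x [^] ?k \<otimes> y [^] ?k = \<one>"
    using x y pow_ord_eq_1[of "x \<otimes> y"] by (simp del: pow_ord_eq_1 flip: nat_pow_distrib)
  have yk: "(y [^] ?k) [^] p = \<one>"
    using y by (metis nat_pow_comm nat_pow_one nat_pow_pow mult.commute)
  have "(x [^] ?k \<otimes> y [^] ?k) [^] p = (x [^] ?k) [^] p"
    using x y yk by (simp add: nat_pow_distrib)
  then have "x [^] (?k * p) = \<one>"
    using k x by (simp add: nat_pow_pow)
  then have "ord x dvd ?k * p" using x pow_eq_id by blast
  then have "ord x dvd ?k"
    using p prime_imp_coprime[OF p] by (simp add: coprime_commute coprime_dvd_mult_left_iff)
  moreover from this have "x [^] ?k = \<one>" using x pow_eq_id by blast
  then have "y [^] ?k = \<one>" using k y by simp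
  then have "p dvd ?k" using pow_eq_id[OF y(1)] ordy by blast
  ultimately show ?thesis
    using prime_imp_coprime[OF p] by (intro divides_mult)
qed

text \<open>
  One element whose powers meet the \<open>p\<close>-torsion nontrivially for all relevant primes at once. This is what lets a
  single character lower all the \<open>p\<close>-ranks simultaneously, so that the number of characters needed is the
  maximum of the \<open>p\<close>-ranks and not their sum.
\<close>

lemma ex_element_ord_divisible_by_all_torsion_primes:
  assumes H: "subgroup H G" and fin: "finite H"
  obtains x where "x \<in> H"
    "\<And>p y. prime p \<Longrightarrow> y \<in> torsion G H p \<Longrightarrow> y \<noteq> \<one> \<Longrightarrow> p dvd ord x"
proof -
  have HG: "H \<subseteq> carrier G" using H by (rule subgroup.subset)
  have "Max (ord ` H) \<in> ord ` H"
    using fin subgroup.one_closed[OF H] by (intro Max_in) auto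
  then obtain x where x: "x \<in> H" "ord x = Max (ord ` H)" by auto
  have "p dvd ord x" if p: "prime p" and y: "y \<in> torsion G H p" "y \<noteq> \<one>" for p y
  proof (rule ccontr)
    assume np: "\<not> p dvd ord x"
    have yH: "y \<in> H" "y [^] p = \<one>" using y by (auto simp: torsion_def)
    have xy: "x \<otimes> y \<in> H" using x yH H by (simp add: subgroup.m_closed)
    have "p * ord x dvd ord (x \<otimes> y)"
      using ord_mult_prime[of x y p] x yH y p np HG by auto
    moreover have fin_order: "0 < ord u" if u: "u \<in> H" for u
    proof -
      interpret H: group "G\<lparr>carrier := H\<rparr>" using H by (rule subgroup_imp_group)
      have "u [^] card H = \<one>"
        using H.pow_order_eq_1[of u] u by (simp add: Coset.order_def flip: nat_pow_consistent)
      then have "ord u dvd card H" using u HG pow_eq_id by blast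
      moreover have "card H > 0" using u fin by (auto simp: card_gt_0_iff)
      ultimately show ?thesis by (auto intro: Nat.gr0I)
    qed
    ultimately have "p * ord x \<le> ord (x \<otimes> y)" using xy by (intro dvd_imp_le) auto
    also have "\<dots> \<le> ord x" using x xy fin by simp
    finally show False using fin_order[OF x(1)] prime_gt_1_nat[OF p] by simp
  qed
  with x show thesis using that by blast
qed

text \<open>
  Start from the trivial subgroup, send \<open>x\<close> to a primitive root of unity of order \<open>ord x\<close>, and extend.
\<close>

lemma ex_character_faithful_on_powers:
  assumes fin: "finite (carrier G)" and x: "x \<in> carrier G"
  obtains \<chi> where "character G (carrier G) \<chi>" "\<And>k::nat. \<chi> (x [^] k) = 1 \<Longrightarrow> x [^] k = \<one>"
proof -
  define z where "z = cis (2 * pi / ord x)"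
  have ord: "0 < ord x" using ord_ge_1[OF fin x] by simp
  have z: "z ^ k = 1 \<longleftrightarrow> x [^] k = \<one>" for k :: nat
  proof -
    have "z ^ k = 1 \<longleftrightarrow> ord x dvd k"
      unfolding z_def using ord by (rule cis_power_eq_1_iff)
    then show ?thesis using x pow_eq_id by blast
  qed
  have "character G {\<one>} (\<lambda>_. 1)" by (simp add: character_def)
  then obtain H \<psi> where H: "subgroup H G" "x \<in> H" "character G H \<psi>" "\<psi> x = z"
    using character_extend_by_element[OF triv_subgroup fin _ x, of "\<lambda>_. 1" z] z by (metis singletonD)
  then obtain \<chi> where \<chi>: "character G (carrier G) \<chi>" "\<And>y. y \<in> H \<Longrightarrow> \<chi> y = \<psi> y"
    using character_extend[OF H(1) fin H(3)] by metis
  have "\<chi> (x [^] k) = z ^ k" for k :: nat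
    using character_pow[OF H(1,3,2)] \<chi>(2) H by (simp add: subgroup_nat_pow_closed)
  with z \<chi>(1) show thesis using that by metis
qed

text \<open>
  Induction on \<open>d\<close>: a character that is faithful on the powers of a suitable \<open>x\<close> lowers every
  nonzero \<open>p\<close>-rank, so the induction hypothesis applies to its kernel in \<open>H\<close>. When all \<open>p\<close>-ranks are zero, the
  group is trivial by Cauchy's theorem.
\<close>

lemma ex_characters_trivial_common_kernel:
  assumes fin: "finite (carrier G)" and "subgroup H G"
    and "\<And>p. prime p \<Longrightarrow> card (torsion G H p) \<le> p ^ d"
  shows "\<exists>X. (\<forall>i<d. character G (carrier G) (X i)) \<and> (\<forall>x\<in>H. (\<forall>i<d. X i x = 1) \<longrightarrow> x = \<one>)"
  using assms(2,3)
proof (induction d arbitrary: H)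
  case 0
  have "finite H" using fin 0(1) by (meson finite_subset subgroup.subset)
  then have "H = {\<one>}" using 0 by (intro trivial_if_no_torsion) auto
  then show ?case by simp
next
  case (Suc d)
  note H = Suc.prems(1)
  have finH: "finite H" using fin H by (meson finite_subset subgroup.subset)
  have HG: "H \<subseteq> carrier G" using H by (rule subgroup.subset)
  obtain x where x: "x \<in> H"
    "\<And>p y. prime p \<Longrightarrow> y \<in> torsion G H p \<Longrightarrow> y \<noteq> \<one> \<Longrightarrow> p dvd ord x"
    using ex_element_ord_divisible_by_all_torsion_primes[OF H finH] by metis
  obtain \<chi> where \<chi>: "character G (carrier G) \<chi>" "\<And>k::nat. \<chi> (x [^] k) = 1 \<Longrightarrow> x [^] k = \<one>"
    using ex_character_faithful_on_powers[OF fin] x(1) HG by blast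
  have \<chi>H: "character G H \<chi>" using \<chi>(1) HG by (rule character_subset)
  define K where "K = {y \<in> H. \<chi> y = 1}"
  have "card (torsion G K p) \<le> p ^ d" if p: "prime p" for p
  proof (cases "\<exists>y \<in> torsion G H p. y \<noteq> \<one>")
    case True
    then have dvd: "p dvd ord x" using x p by blast
    \<comment> \<open>A power of \<open>x\<close> of order exactly \<open>p\<close>: the chosen character cannot be trivial on it.\<close>
    let ?y = "x [^] (ord x div p)"
    have xG: "x \<in> carrier G" using x HG by auto
    have ordx: "0 < ord x" using ord_ge_1[OF fin xG] by simp
    have y: "?y \<in> torsion G H p"
      using x(1) xG dvd H by (simp add: torsion_def nat_pow_pow subgroup_nat_pow_closed)
    have "?y \<noteq> \<one>"
    proof
      assume "?y = \<one>"
      then have "ord x dvd ord x div p" using xG pow_eq_id by blast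
      moreover have "0 < ord x div p" using dvd ordx by (auto elim!: dvdE)
      ultimately have "ord x \<le> ord x div p" by (rule dvd_imp_le)
      then show False using ordx prime_gt_1_nat[OF p] by (metis div_less_dividend leD)
    qed
    then have "\<chi> ?y \<noteq> 1" using \<chi>(2) by blast
    then have "p * card (torsion G K p) \<le> card (torsion G H p)"
      unfolding K_def by (rule prime_times_card_torsion_kernel_le[OF H finH \<chi>H p y])
    also have "\<dots> \<le> p * p ^ d" using Suc.prems(2)[OF p] by simp
    finally show ?thesis using prime_gt_0_nat[OF p] by simp
  next
    case False
    then have "torsion G K p \<subseteq> {\<one>}" by (auto simp: torsion_def K_def)
    then have "card (torsion G K p) \<le> card {\<one>}" by (intro card_mono) auto
    also have "\<dots> \<le> p ^ d" using prime_gt_0_nat[OF p] by simp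
    finally show ?thesis .
  qed
  moreover have "subgroup K G" unfolding K_def by (rule character_kernel_subgroup[OF H \<chi>H])
  ultimately obtain X where X: "\<forall>i<d. character G (carrier G) (X i)"
      "\<forall>x\<in>K. (\<forall>i<d. X i x = 1) \<longrightarrow> x = \<one>"
    using Suc.IH by blast
  show ?case
  proof (intro exI[of _ "X(d := \<chi>)"] conjI ballI allI impI)
    fix i assume "i < Suc d"
    then show "character G (carrier G) ((X(d := \<chi>)) i)" using X(1) \<chi>(1) by (auto simp: less_Suc_eq)
  next
    fix y assume y: "y \<in> H" "\<forall>i<Suc d. (X(d := \<chi>)) i y = 1"
    have "\<chi> y = 1" "\<forall>i<d. X i y = 1" using y(2) by (metis fun_upd_same lessI, metis fun_upd_other less_SucI nat_neq_iff)
    with y(1) X(2) show "y = \<one>" by (auto simp: K_def)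
  qed
qed

lemma ex_separating_characters:
  assumes fin: "finite (carrier G)"
    and small: "\<And>p. prime p \<Longrightarrow> card (torsion G (carrier G) p) \<le> p ^ d"
  obtains X where "\<And>i. i < d \<Longrightarrow> character G (carrier G) (X i)"
    "\<And>x y. x \<in> carrier G \<Longrightarrow> y \<in> carrier G \<Longrightarrow> \<forall>i<d. X i x = X i y \<Longrightarrow> x = y"
proof -
  obtain X where X: "\<And>i. i < d \<Longrightarrow> character G (carrier G) (X i)"
    and kernel: "\<And>x. x \<in> carrier G \<Longrightarrow> (\<And>i. i < d \<Longrightarrow> X i x = 1) \<Longrightarrow> x = \<one>"
    using ex_characters_trivial_common_kernel[OF fin subgroup_self small] by blast
  have "x = y"
    if xy: "x \<in> carrier G" "y \<in> carrier G" and eq: "\<forall>i<d. X i x = X i y" for x y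
  proof -
    have "X i (x \<otimes> inv y) = 1" if "i < d" for i
      using character_eq_iff[OF subgroup_self X[OF that] xy] eq that by simp
    then have "x \<otimes> inv y = \<one>" using xy by (intro kernel) auto
    then show "x = y" using xy inv_solve_right[of \<one> x y] by simp
  qed
  with X show thesis by (rule that)
qed

end

section \<open>Common eigenvectors and the lower bound\<close>

locale finite_abelian_rep = comm_group G for G (structure) +
  fixes d :: nat and \<rho> :: "'a \<Rightarrow> complex mat"
  assumes finite_carrier: "finite (carrier G)"
    and rep_carrier: "x \<in> carrier G \<Longrightarrow> \<rho> x \<in> carrier_mat d d"
    and rep_one: "\<rho> \<one> = 1\<^sub>m d"
    and rep_mult: "x \<in> carrier G \<Longrightarrow> y \<in> carrier G \<Longrightarrow> \<rho> (x \<otimes> y) = \<rho> x * \<rho> y"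
begin

lemma rep_vec_carrier:
  "x \<in> carrier G \<Longrightarrow> v \<in> carrier_vec d \<Longrightarrow> \<rho> x *\<^sub>v v \<in> carrier_vec d"
  using rep_carrier by (rule mult_mat_vec_carrier)

lemma rep_mult_vec:
  "x \<in> carrier G \<Longrightarrow> y \<in> carrier G \<Longrightarrow> v \<in> carrier_vec d \<Longrightarrow> \<rho> (x \<otimes> y) *\<^sub>v v = \<rho> x *\<^sub>v (\<rho> y *\<^sub>v v)"
  by (simp add: rep_mult assoc_mult_mat_vec[OF rep_carrier rep_carrier])

text \<open>
  When \<open>x [^] m = \<one>\<close> and \<open>c ^ m = 1\<close>, this is \<open>m\<close> times the projection onto the \<open>c\<close>-eigenspace of \<open>\<rho> x\<close>, i.e. the
  discrete Fourier transform of the orbit of \<open>v\<close> under the powers of \<open>x\<close>.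
\<close>

definition eigenprojection :: "nat \<Rightarrow> 'a \<Rightarrow> complex \<Rightarrow> complex vec \<Rightarrow> complex vec" where
  "eigenprojection m x c v = Matrix.vec d (\<lambda>a. \<Sum>i<m. inverse c ^ i * (\<rho> (x [^] i) *\<^sub>v v) $ a)"

lemma eigenprojection_carrier: "eigenprojection m x c v \<in> carrier_vec d"
  by (simp add: eigenprojection_def)

text \<open>
  Because the group is commutative, averaging over powers of \<open>x\<close> commutes with every \<open>\<rho> y\<close>; hence it preserves
  eigenvectors of all the other group elements.
\<close>

lemma rep_eigenprojection:
  assumes x: "x \<in> carrier G" and y: "y \<in> carrier G" and v: "v \<in> carrier_vec d"
  shows "\<rho> y *\<^sub>v eigenprojection m x c v = eigenprojection m x c (\<rho> y *\<^sub>v v)"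
proof (rule eq_vecI)
  fix a assume "a < dim_vec (eigenprojection m x c (\<rho> y *\<^sub>v v))"
  then have a: "a < d" by (simp add: eigenprojection_def)
  have comm: "\<rho> (x [^] i) *\<^sub>v (\<rho> y *\<^sub>v v) = \<rho> y *\<^sub>v (\<rho> (x [^] i) *\<^sub>v v)" for i :: nat
    using assms by (simp flip: rep_mult_vec add: m_comm)
  have dims: "dim_row (\<rho> z) = d" "dim_col (\<rho> z) = d" if "z \<in> carrier G" for z
    using rep_carrier[OF that] by auto
  have "(\<rho> y *\<^sub>v eigenprojection m x c v) $ a
      = (\<Sum>b<d. \<rho> y $$ (a, b) * (\<Sum>i<m. inverse c ^ i * (\<rho> (x [^] i) *\<^sub>v v) $ b))"
    using a y by (simp add: eigenprojection_def scalar_prod_def dims atLeast0LessThan)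
  also have "\<dots> = (\<Sum>i<m. inverse c ^ i * (\<Sum>b<d. \<rho> y $$ (a, b) * (\<rho> (x [^] i) *\<^sub>v v) $ b))"
    by (simp add: sum_distrib_left mult.left_commute) (rule sum.swap)
  also have "\<dots> = (\<Sum>i<m. inverse c ^ i * (\<rho> (x [^] i) *\<^sub>v (\<rho> y *\<^sub>v v)) $ a)"
    using a x y by (simp only: comm) (simp add: scalar_prod_def dims atLeast0LessThan)
  also have "\<dots> = eigenprojection m x c (\<rho> y *\<^sub>v v) $ a"
    using a by (simp add: eigenprojection_def)
  finally show "(\<rho> y *\<^sub>v eigenprojection m x c v) $ a = eigenprojection m x c (\<rho> y *\<^sub>v v) $ a" .
next
  show "dim_vec (\<rho> y *\<^sub>v eigenprojection m x c v) = dim_vec (eigenprojection m x c (\<rho> y *\<^sub>v v))"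
    using rep_carrier[OF y] by (auto simp: eigenprojection_def)
qed

lemma eigenprojection_smult:
  assumes x: "x \<in> carrier G" and v: "v \<in> carrier_vec d"
  shows "eigenprojection m x c (k \<cdot>\<^sub>v v) = k \<cdot>\<^sub>v eigenprojection m x c v"
proof -
  have "\<rho> (x [^] i) *\<^sub>v (k \<cdot>\<^sub>v v) = k \<cdot>\<^sub>v (\<rho> (x [^] i) *\<^sub>v v)" for i :: nat
    using rep_carrier x v by (intro mult_mat_vec) auto
  moreover have "dim_vec (\<rho> (x [^] i) *\<^sub>v v) = d" for i :: nat
    using carrier_vecD[OF rep_vec_carrier[of "x [^] i" v]] x v by simp
  ultimately show ?thesis
    by (intro eq_vecI) (auto simp: eigenprojection_def sum_distrib_left mult.left_commute)
qed

lemma eigenprojection_eigenvector: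
  assumes x: "x \<in> carrier G" "x [^] m = \<one>" and c: "c ^ m = 1" "c \<noteq> 0" and v: "v \<in> carrier_vec d"
  shows "\<rho> x *\<^sub>v eigenprojection m x c v = c \<cdot>\<^sub>v eigenprojection m x c v"
proof (rule eq_vecI)
  fix a assume "a < dim_vec (c \<cdot>\<^sub>v eigenprojection m x c v)"
  then have a: "a < d" by (simp add: eigenprojection_def)
  \<comment> \<open>Applying \<open>\<rho> x\<close> shifts this sequence by one place, and it is periodic with period \<open>m\<close>.\<close>
  define t where "t i = inverse c ^ i * (\<rho> (x [^] i) *\<^sub>v v) $ a" for i :: nat
  have t: "t m = t 0" using x c by (simp add: t_def power_inverse)
  have "(\<rho> x *\<^sub>v eigenprojection m x c v) $ a
      = (\<Sum>i<m. inverse c ^ i * (\<rho> (x [^] i) *\<^sub>v (\<rho> x *\<^sub>v v)) $ a)"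
    using a by (simp add: rep_eigenprojection[OF x(1) x(1) v]) (simp add: eigenprojection_def)
  also have "\<dots> = (\<Sum>i<m. c * t (Suc i))"
    using x v c by (intro sum.cong) (simp_all add: t_def flip: rep_mult_vec)
  also have "\<dots> = c * (\<Sum>i<m. t (Suc i))"
    by (simp add: sum_distrib_left)
  also have "(\<Sum>i<m. t (Suc i)) = (\<Sum>i<m. t i)"
    using t sum.lessThan_Suc_shift[of t m] by (simp add: add.commute)
  finally show "(\<rho> x *\<^sub>v eigenprojection m x c v) $ a = (c \<cdot>\<^sub>v eigenprojection m x c v) $ a"
    using a by (simp add: eigenprojection_def t_def)
next
  show "dim_vec (\<rho> x *\<^sub>v eigenprojection m x c v) = dim_vec (c \<cdot>\<^sub>v eigenprojection m x c v)"
    using rep_carrier[OF x(1)] by (auto simp: eigenprojection_def)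
qed

text \<open>
  Fourier inversion: the geometric sums over the \<open>m\<close>-th roots of unity vanish except for the exponent \<open>0\<close>.
\<close>

lemma sum_eigenprojections:
  assumes x: "x \<in> carrier G" and v: "v \<in> carrier_vec d" and m: "0 < m" and a: "a < d"
  defines "\<zeta> \<equiv> cis (2 * pi / real m)"
  shows "(\<Sum>j<m. eigenprojection m x (\<zeta> ^ j) v $ a) = of_nat m * v $ a"
proof -
  have roots: "(\<Sum>j<m. inverse (\<zeta> ^ j) ^ i) = (if i = 0 then of_nat m else 0)" if i: "i < m" for i
  proof (cases "i = 0")
    case False
    define q where "q = inverse \<zeta> ^ i"
    have "\<zeta> ^ i \<noteq> 1" "(\<zeta> ^ i) ^ m = 1"
      using False i cis_power_eq_1_iff[OF m] by (auto simp: \<zeta>_def simp flip: power_mult)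
    then have q: "q \<noteq> 1" "q ^ m = 1" by (auto simp: q_def power_inverse)
    have "(\<Sum>j<m. inverse (\<zeta> ^ j) ^ i) = (\<Sum>j<m. q ^ j)"
      by (simp add: q_def power_inverse mult.commute flip: power_mult)
    also have "\<dots> = 0" using q geometric_sum[of q m] by simp
    finally show ?thesis using False by simp
  qed simp
  have "(\<Sum>j<m. eigenprojection m x (\<zeta> ^ j) v $ a)
      = (\<Sum>i<m. (\<Sum>j<m. inverse (\<zeta> ^ j) ^ i) * (\<rho> (x [^] i) *\<^sub>v v) $ a)"
    using a by (simp add: eigenprojection_def sum_distrib_right) (rule sum.swap)
  also have "\<dots> = (\<Sum>i<m. if i = 0 then of_nat m * v $ a else 0)"
    using v by (intro sum.cong) (auto simp: roots rep_one)
  also have "\<dots> = of_nat m * v $ a" using m by simp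
  finally show ?thesis .
qed

text \<open>
  If all components for eigenvalues other than \<open>1\<close> vanished, Fourier inversion would leave \<open>v\<close> as a multiple of
  its own component for the eigenvalue \<open>1\<close>, hence fixed by \<open>\<rho> x\<close>.
\<close>

lemma ex_nonzero_eigenprojection:
  assumes x: "x \<in> carrier G" "x [^] m = \<one>" and m: "0 < m" and v: "v \<in> carrier_vec d"
    and moved: "\<rho> x *\<^sub>v v \<noteq> v"
  obtains c where "c \<noteq> 1" "c ^ m = 1" "c \<noteq> 0" "eigenprojection m x c v \<noteq> 0\<^sub>v d"
proof -
  define \<zeta> where "\<zeta> = cis (2 * pi / real m)"
  have \<zeta>: "(\<zeta> ^ j) ^ m = 1" "\<zeta> ^ j \<noteq> 0" "\<zeta> ^ j \<noteq> 1 \<longleftrightarrow> \<not> m dvd j" for j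
    using cis_power_eq_1_iff[OF m] by (auto simp: \<zeta>_def simp flip: power_mult)
  have "\<exists>j<m. j \<noteq> 0 \<and> eigenprojection m x (\<zeta> ^ j) v \<noteq> 0\<^sub>v d"
  proof (rule ccontr)
    assume "\<not> ?thesis"
    then have zero: "eigenprojection m x (\<zeta> ^ j) v = 0\<^sub>v d" if "j < m" "j \<noteq> 0" for j
      using that by blast
    have eq: "eigenprojection m x 1 v = of_nat m \<cdot>\<^sub>v v"
    proof (rule eq_vecI)
      fix a assume "a < dim_vec (of_nat m \<cdot>\<^sub>v v)"
      then have a: "a < d" using v by simp
      have "of_nat m * v $ a = (\<Sum>j<m. eigenprojection m x (\<zeta> ^ j) v $ a)"
        unfolding \<zeta>_def by (rule sum_eigenprojections[OF x(1) v m a, symmetric])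
      also have "\<dots> = (\<Sum>j<m. if j = 0 then eigenprojection m x 1 v $ a else 0)"
        using a by (intro sum.cong) (auto simp: zero)
      also have "\<dots> = eigenprojection m x 1 v $ a" using m by simp
      finally show "eigenprojection m x 1 v $ a = (of_nat m \<cdot>\<^sub>v v) $ a"
        using a v by simp
    qed (use v in \<open>simp add: eigenprojection_def\<close>)
    have "\<rho> x *\<^sub>v (of_nat m \<cdot>\<^sub>v v) = of_nat m \<cdot>\<^sub>v v"
      using eigenprojection_eigenvector[OF x, of 1 v] v eq by simp
    then have "of_nat m \<cdot>\<^sub>v (\<rho> x *\<^sub>v v) = of_nat m \<cdot>\<^sub>v v"
      using mult_mat_vec[OF rep_carrier[OF x(1)] v, of "of_nat m"] by simp
    then have "(1 / of_nat m) \<cdot>\<^sub>v (of_nat m \<cdot>\<^sub>v (\<rho> x *\<^sub>v v)) = (1 / of_nat m) \<cdot>\<^sub>v (of_nat m \<cdot>\<^sub>v v)"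
      by simp
    then have "\<rho> x *\<^sub>v v = v" using m by (simp add: smult_smult_assoc)
    with moved show False by simp
  qed
  then obtain j where j: "j < m" "j \<noteq> 0" "eigenprojection m x (\<zeta> ^ j) v \<noteq> 0\<^sub>v d" by blast
  then have "\<not> m dvd j" by (auto dest: dvd_imp_le)
  then show thesis using j \<zeta> that[of "\<zeta> ^ j"] by blast
qed

text \<open>
  Commuting matrices of finite order have a common eigenvector, found by projecting successively for the elements of
  \<open>F\<close>. Starting from an eigenvector of \<open>g\<close> with eigenvalue other than \<open>1\<close>, this property of \<open>g\<close> survives all later
  projections.
\<close>

lemma ex_common_eigenvector:
  fixes m :: nat
  assumes g: "g \<in> carrier G" "\<rho> g \<noteq> 1\<^sub>m d" "g [^] m = \<one>" and m: "0 < m"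
    and F: "finite F" "F \<subseteq> carrier G" "\<And>x. x \<in> F \<Longrightarrow> x [^] m = \<one>"
  shows "\<exists>v \<in> carrier_vec d. v \<noteq> 0\<^sub>v d \<and> (\<exists>c. c \<noteq> 1 \<and> \<rho> g *\<^sub>v v = c \<cdot>\<^sub>v v) \<and>
           (\<forall>x\<in>F. \<exists>c. \<rho> x *\<^sub>v v = c \<cdot>\<^sub>v v)"
  using F
proof (induction F rule: finite_induct)
  case empty
  have "\<exists>w \<in> carrier_vec d. \<rho> g *\<^sub>v w \<noteq> w"
  proof (rule ccontr)
    assume "\<not> ?thesis"
    then have fixed: "\<rho> g *\<^sub>v unit_vec d j = unit_vec d j" for j by simp
    have "\<rho> g = 1\<^sub>m d"
    proof (rule eq_matI)
      fix i j assume "i < dim_row (1\<^sub>m d :: complex mat)" "j < dim_col (1\<^sub>m d :: complex mat)"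
      then show "\<rho> g $$ (i, j) = 1\<^sub>m d $$ (i, j)"
        using arg_cong[OF fixed[of j], of "\<lambda>v. v $ i"] rep_carrier[OF g(1)] by auto
    qed (use rep_carrier[OF g(1)] in auto)
    with g show False by simp
  qed
  then obtain w where w: "w \<in> carrier_vec d" "\<rho> g *\<^sub>v w \<noteq> w" by blast
  obtain c where c: "c \<noteq> 1" "c ^ m = 1" "c \<noteq> 0" "eigenprojection m g c w \<noteq> 0\<^sub>v d"
    using ex_nonzero_eigenprojection[OF g(1,3) m w] .
  then show ?case
    using eigenprojection_eigenvector[OF g(1,3) c(2,3) w(1)]
    by (intro bexI[of _ "eigenprojection m g c w"]) (auto simp: eigenprojection_carrier)
next
  case (insert x F)
  then obtain v where v: "v \<in> carrier_vec d" "v \<noteq> 0\<^sub>v d" "\<exists>c. c \<noteq> 1 \<and> \<rho> g *\<^sub>v v = c \<cdot>\<^sub>v v"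
      "\<forall>y\<in>F. \<exists>c. \<rho> y *\<^sub>v v = c \<cdot>\<^sub>v v" by auto
  have x: "x \<in> carrier G" "x [^] m = \<one>" and FG: "F \<subseteq> carrier G" using insert.prems by auto
  show ?case
  proof (cases "\<rho> x *\<^sub>v v = v")
    case True
    then have "\<rho> x *\<^sub>v v = 1 \<cdot>\<^sub>v v" by simp
    with v show ?thesis by blast
  next
    case False
    then obtain c where c: "c ^ m = 1" "c \<noteq> 0" "eigenprojection m x c v \<noteq> 0\<^sub>v d"
      using ex_nonzero_eigenprojection[OF x m v(1)] by metis
    \<comment> \<open>If \<open>\<rho> x\<close> moves \<open>v\<close>, replace \<open>v\<close> by an eigencomponent; all eigenvalues found so far are kept.\<close>
    let ?u = "eigenprojection m x c v"
    have keep: "\<rho> y *\<^sub>v ?u = b \<cdot>\<^sub>v ?u" if "y \<in> carrier G" "\<rho> y *\<^sub>v v = b \<cdot>\<^sub>v v" for y b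
      using that rep_eigenprojection[OF x(1) that(1) v(1)] eigenprojection_smult[OF x(1) v(1)] by simp
    show ?thesis
    proof (intro bexI[of _ ?u] conjI ballI)
      show "\<exists>c. c \<noteq> 1 \<and> \<rho> g *\<^sub>v ?u = c \<cdot>\<^sub>v ?u" using v(3) keep[OF g(1)] by blast
      fix y assume "y \<in> insert x F"
      then show "\<exists>c. \<rho> y *\<^sub>v ?u = c \<cdot>\<^sub>v ?u"
        using eigenprojection_eigenvector[OF x c(1,2) v(1)] v(4) keep FG by blast
    qed (use c in \<open>auto simp: eigenprojection_carrier\<close>)
  qed
qed

lemma smult_vec_cancel:
  fixes v :: "complex vec"
  assumes "v \<in> carrier_vec d" "v \<noteq> 0\<^sub>v d" "b \<cdot>\<^sub>v v = c \<cdot>\<^sub>v v"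
  shows "b = c"
proof -
  obtain a where "a < d" "v $ a \<noteq> 0" using assms(1,2) by (auto simp: vec_eq_iff)
  moreover have "(b \<cdot>\<^sub>v v) $ a = (c \<cdot>\<^sub>v v) $ a" using assms(3) by simp
  ultimately show ?thesis using assms(1) by simp
qed

lemma ex_eigencharacter:
  assumes K: "subgroup K G" and v: "v \<in> carrier_vec d" "v \<noteq> 0\<^sub>v d"
    and eigen: "\<And>x. x \<in> K \<Longrightarrow> \<exists>c. \<rho> x *\<^sub>v v = c \<cdot>\<^sub>v v"
  obtains \<chi> where "character G K \<chi>" "\<And>x. x \<in> K \<Longrightarrow> \<rho> x *\<^sub>v v = \<chi> x \<cdot>\<^sub>v v"
proof -
  have KG: "K \<subseteq> carrier G" using K by (rule subgroup.subset)
  obtain \<chi> where \<chi>: "\<And>x. x \<in> K \<Longrightarrow> \<rho> x *\<^sub>v v = \<chi> x \<cdot>\<^sub>v v" using eigen by metis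
  have "character G K \<chi>"
    unfolding character_def
  proof (intro conjI ballI)
    have "\<chi> \<one> \<cdot>\<^sub>v v = 1 \<cdot>\<^sub>v v"
      using \<chi>[of \<one>] v K by (simp add: rep_one subgroup.one_closed)
    then show "\<chi> \<one> = 1" by (rule smult_vec_cancel[OF v])
    fix x y assume xy: "x \<in> K" "y \<in> K"
    then have xyG: "x \<in> carrier G" "y \<in> carrier G" using KG by auto
    have "\<chi> (x \<otimes> y) \<cdot>\<^sub>v v = \<rho> x *\<^sub>v (\<chi> y \<cdot>\<^sub>v v)"
      using \<chi>[OF subgroup.m_closed[OF K xy]] \<chi>[OF xy(2)] rep_mult_vec[OF xyG v(1)] by simp
    also have "\<dots> = (\<chi> x * \<chi> y) \<cdot>\<^sub>v v"
      using \<chi>[OF xy(1)] mult_mat_vec[OF rep_carrier[OF xyG(1)] v(1)]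
      by (simp add: smult_smult_assoc mult.commute)
    finally show "\<chi> (x \<otimes> y) = \<chi> x * \<chi> y" by (rule smult_vec_cancel[OF v])
  qed
  with \<chi> show thesis using that by blast
qed

text \<open>
  The lower bound on the dimension. Take an element \<open>g\<close> of \<open>K\<close> other than \<open>\<one>\<close> and a common eigenvector \<open>v\<close> of \<open>K\<close>
  that \<open>g\<close> moves. The span of \<open>S\<close> is fixed by \<open>g\<close>, so \<open>v\<close> lies outside it and enlarges the independent set,
  while \<open>v\<close> is fixed by the kernel of its eigencharacter, whose index in \<open>K\<close> is at most the number
  \<open>p\<close> of \<open>p\<close>-th roots of unity. So each of the at most \<open>d - card S\<close> further independent vectors costs at most a
  factor \<open>p\<close> until \<open>K\<close> is trivial.
\<close>

lemma card_subgroup_le_of_fixed_vectors: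
  assumes inj: "inj_on \<rho> (carrier G)" and p: "0 < p"
    and "subgroup K G" "\<And>x. x \<in> K \<Longrightarrow> x [^] p = \<one>"
    and "S \<subseteq> carrier_vec d" "\<not> module.lin_dep class_ring (module_vec TYPE(complex) d) S"
    and "\<And>x v. x \<in> K \<Longrightarrow> v \<in> S \<Longrightarrow> \<rho> x *\<^sub>v v = v"
  shows "card K \<le> p ^ (d - card S)"
  using assms(3-)
proof (induction "card K" arbitrary: K S rule: less_induct)
  case less
  interpret V: vec_space "TYPE(complex)" d .
  note K = less.prems(1) and exponent = less.prems(2) and S = less.prems(3,4) and S_fixed = less.prems(5)
  have KG: "K \<subseteq> carrier G" using K by (rule subgroup.subset)
  then have finK: "finite K" using finite_carrier finite_subset by blast
  show ?case
  proof (cases "K = {\<one>}")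
    case True
    then show ?thesis using p by simp
  next
    case False
    then obtain g where g: "g \<in> K" "g \<noteq> \<one>" using subgroup.one_closed[OF K] by blast
    have gG: "g \<in> carrier G" using g KG by auto
    have "\<rho> g \<noteq> 1\<^sub>m d" using inj_onD[OF inj, of g \<one>] g gG rep_one by auto
    then obtain v where v: "v \<in> carrier_vec d" "v \<noteq> 0\<^sub>v d" "\<exists>c. c \<noteq> 1 \<and> \<rho> g *\<^sub>v v = c \<cdot>\<^sub>v v"
        "\<forall>x\<in>K. \<exists>c. \<rho> x *\<^sub>v v = c \<cdot>\<^sub>v v"
      using ex_common_eigenvector[OF gG _ exponent[OF g(1)] p finK KG exponent] by blast
    obtain \<chi> where \<chi>: "character G K \<chi>" "\<And>x. x \<in> K \<Longrightarrow> \<rho> x *\<^sub>v v = \<chi> x \<cdot>\<^sub>v v"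
      using ex_eigencharacter[OF K v(1,2)] v(4) by blast
    have \<chi>g: "\<chi> g \<noteq> 1" using v(3) \<chi>(2)[OF g(1)] smult_vec_cancel[OF v(1,2)] by metis
    \<comment> \<open>The stabiliser of \<open>v\<close> in \<open>K\<close>.\<close>
    define L where "L = {x \<in> K. \<chi> x = 1}"
    have L: "subgroup L G" unfolding L_def by (rule character_kernel_subgroup[OF K \<chi>(1)])
    have "L \<subset> K" using \<chi>g g by (auto simp: L_def)
    then have L_less: "card L < card K" using finK by (rule psubset_card_mono[rotated])
    have "\<chi> ` K \<subseteq> {z. z ^ p = 1}"
      using character_pow[OF K \<chi>(1), of _ p] exponent character_one[OF \<chi>(1)] by auto
    then have "card (\<chi> ` K) \<le> card {z::complex. z ^ p = 1}"
      using p by (intro card_mono finite_roots_unity) auto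
    also have "\<dots> = p" using p by (rule card_roots_unity_eq)
    finally have card_K: "card K \<le> card L * p"
      using card_eq_card_kernel_times_card_image[OF K finK \<chi>(1)] by (simp add: L_def)
    have "V.span S \<subseteq> {u \<in> carrier_vec d. \<rho> g *\<^sub>v u = u}"
    proof (rule V.span_is_subset)
      show "S \<subseteq> {u \<in> carrier_vec d. \<rho> g *\<^sub>v u = u}" using S S_fixed g by auto
      show "submodule class_ring {u \<in> carrier_vec d. \<rho> g *\<^sub>v u = u} V.V"
        using rep_carrier[OF gG] V.module_axioms
        by (unfold_locales) (auto simp: mult_add_distrib_mat_vec mult_mat_vec)
    qed
    moreover have "\<rho> g *\<^sub>v v \<noteq> v"
      using \<chi>(2)[OF g(1)] \<chi>g smult_vec_cancel[OF v(1,2), of "\<chi> g" 1] by auto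
    ultimately have v_span: "v \<notin> V.span S" by blast
    have vS: "v \<notin> S" using v_span V.span_mem[OF S(1)] by blast
    have indep: "\<not> V.lin_dep (insert v S)"
      using V.lin_dep_iff_in_span[OF S v(1) vS] v_span by simp
    have sub: "insert v S \<subseteq> carrier_vec d" using S v by auto
    have "card (insert v S) \<le> d"
      using V.li_le_dim(2)[OF V.fin_dim] sub indep V.dim_is_n by simp
    moreover have "finite S" using V.li_le_dim(1)[OF V.fin_dim] S by simp
    ultimately have card_S: "card (insert v S) = Suc (card S)" "Suc (card S) \<le> d" using vS by auto
    have "card L \<le> p ^ (d - card (insert v S))"
    proof (rule less.hyps[OF L_less L _ sub indep])
      show "\<rho> x *\<^sub>v u = u" if "x \<in> L" "u \<in> insert v S" for x u
        using that \<chi>(2) S_fixed v(1) by (auto simp: L_def)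
    qed (use exponent in \<open>auto simp: L_def\<close>)
    then have "card L * p \<le> p ^ (d - Suc (card S)) * p" using card_S by simp
    also have "\<dots> = p ^ (d - card S)" using card_S(2) by (simp add: Suc_diff_Suc flip: power_Suc2)
    finally show ?thesis using card_K by simp
  qed
qed

lemma card_torsion_le_of_faithful:
  assumes "inj_on \<rho> (carrier G)" "0 < p"
  shows "card (torsion G (carrier G) p) \<le> p ^ d"
proof -
  interpret V: vec_space "TYPE(complex)" d .
  have "\<not> V.lin_dep {}" by (simp add: V.lin_dep_def)
  then show ?thesis
    using card_subgroup_le_of_fixed_vectors[OF assms torsion_subgroup[OF subgroup_self], of p "{}"]
    by (simp add: torsion_def)
qed

end

section \<open>Representation dimension of finite abelian groups\<close>

lemma carrier_GL_complex: "carrier (GL_complex d) = Units (ring_mat TYPE(complex) d ())"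
  and mult_GL_complex: "A \<otimes>\<^bsub>GL_complex d\<^esub> B = A * B"
  and one_GL_complex: "\<one>\<^bsub>GL_complex d\<^esub> = 1\<^sub>m d"
  by (simp_all add: GL_complex_def units_of_def ring_mat_simps)

lemma group_GL_complex: "group (GL_complex d)"
proof -
  interpret ring "ring_mat TYPE(complex) d ()" by (rule ring_mat)
  show ?thesis unfolding GL_complex_def by (rule units_group)
qed

text \<open>
  The characters that separate the points of \<open>G\<close> are the diagonal entries of a faithful representation.
\<close>

lemma (in comm_group) mon_GL_complex_nonempty:
  assumes fin: "finite (carrier G)"
    and "\<And>p. prime p \<Longrightarrow> card (torsion G (carrier G) p) \<le> p ^ d"
  shows "mon G (GL_complex d) \<noteq> {}"
proof -
  obtain X where X: "\<And>i. i < d \<Longrightarrow> character G (carrier G) (X i)"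
    and sep: "\<And>x y. x \<in> carrier G \<Longrightarrow> y \<in> carrier G \<Longrightarrow> \<forall>i<d. X i x = X i y \<Longrightarrow> x = y"
    using ex_separating_characters[OF assms] by blast
  define f where "f x = mat_diag d (\<lambda>i. X i x)" for x
  have diag_cong: "mat_diag d u = mat_diag d w" if "\<And>i. i < d \<Longrightarrow> u i = w i" for u w :: "nat \<Rightarrow> complex"
    using that by (auto simp: mat_diag_def intro!: eq_matI)
  have one: "f \<one> = 1\<^sub>m d"
  proof -
    have "f \<one> = mat_diag d (\<lambda>_. 1)"
      unfolding f_def using X by (intro diag_cong) (rule character_one)
    then show ?thesis by simp
  qed
  have mult: "f (x \<otimes> y) = f x * f y" if "x \<in> carrier G" "y \<in> carrier G" for x y
    unfolding f_def using that by (auto intro!: diag_cong character_mult[OF X])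
  have "f \<in> hom G (GL_complex d)"
  proof (rule homI)
    fix x assume x: "x \<in> carrier G"
    have "f x * f (inv x) = 1\<^sub>m d" "f (inv x) * f x = 1\<^sub>m d"
      using x one by (simp_all flip: mult)
    moreover have "f y \<in> carrier_mat d d" for y by (simp add: f_def)
    ultimately show "f x \<in> carrier (GL_complex d)"
      by (auto simp: carrier_GL_complex Units_def ring_mat_simps)
  qed (simp add: mult mult_GL_complex)
  moreover have "inj_on f (carrier G)"
  proof (rule inj_onI)
    fix x y assume xy: "x \<in> carrier G" "y \<in> carrier G" "f x = f y"
    show "x = y"
    proof (rule sep[OF xy(1,2)], intro allI impI)
      fix i assume i: "i < d"
      have "f x $$ (i, i) = f y $$ (i, i)" using xy by simp
      then show "X i x = X i y" using i by (simp add: f_def mat_diag_def)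
    qed
  qed
  ultimately show ?thesis by (auto simp: mon_def)
qed

lemma (in comm_group) card_torsion_le_of_mon:
  assumes fin: "finite (carrier G)" and f: "f \<in> mon G (GL_complex d)" and p: "0 < p"
  shows "card (torsion G (carrier G) p) \<le> p ^ d"
proof -
  have hom: "f \<in> hom G (GL_complex d)" and inj: "inj_on f (carrier G)" using f by (auto simp: mon_def)
  interpret finite_abelian_rep G d f
  proof
    show "f x \<in> carrier_mat d d" if "x \<in> carrier G" for x
      using hom_in_carrier[OF hom that] by (simp add: carrier_GL_complex Units_def ring_mat_simps)
    show "f \<one> = 1\<^sub>m d"
      using hom_one[OF hom group_axioms group_GL_complex] by (simp add: one_GL_complex)
    show "f (x \<otimes> y) = f x * f y" if "x \<in> carrier G" "y \<in> carrier G" for x y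
      using hom_mult[OF hom that] by (simp add: mult_GL_complex)
  qed (rule fin)
  show ?thesis by (rule card_torsion_le_of_faithful[OF inj p])
qed

lemma (in comm_group) rdim_le:
  assumes "finite (carrier G)" "\<And>p. prime p \<Longrightarrow> card (torsion G (carrier G) p) \<le> p ^ d"
  shows "rdim G \<le> d"
  unfolding rdim_def using mon_GL_complex_nonempty[OF assms] by (rule Least_le)

text \<open>
  The dimension \<open>card (carrier G)\<close> is a crude one in which a faithful representation is known to exist; then the
  least dimension is also attained.
\<close>

lemma (in comm_group) card_torsion_le_rdim:
  assumes fin: "finite (carrier G)" and p: "0 < p"
  shows "card (torsion G (carrier G) p) \<le> p ^ rdim G"
proof -
  have "mon G (GL_complex (card (carrier G))) \<noteq> {}"
  proof (rule mon_GL_complex_nonempty[OF fin])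
    fix q :: nat assume q: "prime q"
    have "card (torsion G (carrier G) q) \<le> card (carrier G)"
      using fin by (intro card_mono) (auto simp: torsion_def)
    also have "\<dots> \<le> q ^ card (carrier G)"
      using prime_gt_1_nat[OF q] by (intro less_imp_le power_gt_expt) auto
    finally show "card (torsion G (carrier G) q) \<le> q ^ card (carrier G)" .
  qed
  then have "mon G (GL_complex (rdim G)) \<noteq> {}" unfolding rdim_def by (rule LeastI)
  then show ?thesis using card_torsion_le_of_mon[OF fin _ p] by blast
qed

lemma (in group) eq_one_if_coprime_powers:
  assumes "x \<in> carrier G" "x [^] (a::nat) = \<one>" "x [^] (b::nat) = \<one>" "coprime a b"
  shows "x = \<one>"
proof -
  have "ord x dvd a" "ord x dvd b" using assms by (simp_all add: pow_eq_id)
  then have "ord x = 1" using assms(4) coprime_common_divisor_nat by blast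
  then show ?thesis using ord_eq_1[OF assms(1)] by simp
qed

lemma (in group) card_prime_exponent:
  assumes fin: "finite (carrier G)" and p: "prime p"
    and exponent: "\<And>x. x \<in> carrier G \<Longrightarrow> x [^] (p::nat) = \<one>"
  obtains k where "card (carrier G) = p ^ k"
proof -
  have "card (carrier G) \<noteq> 0" using fin one_closed by auto
  then obtain m where m: "card (carrier G) = p ^ multiplicity p (card (carrier G)) * m" "\<not> p dvd m"
    using multiplicity_decompose'[of "card (carrier G)" p] p by (metis not_prime_unit)
  have "m = 1"
  proof (rule ccontr)
    assume "m \<noteq> 1"
    then obtain q where q: "prime q" "q dvd m" using prime_factor_nat by blast
    then have "q dvd card (carrier G)" using m(1) by (metis dvd_mult)
    then obtain x where x: "x \<in> torsion G (carrier G) q" "x \<noteq> \<one>"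
      using cauchy[OF subgroup_self fin q(1)] by blast
    have "coprime p q" using p q m(2) primes_coprime by blast
    then show False
      using eq_one_if_coprime_powers[of x p q] x exponent by (auto simp: torsion_def)
  qed
  then show thesis using m(1) that by simp
qed

lemma (in comm_group) card_torsion_le_of_prime_exponent:
  assumes fin: "finite (carrier G)" and p: "prime p" and exponent: "\<And>x. x \<in> carrier G \<Longrightarrow> x [^] p = \<one>"
    and card: "card (carrier G) = p ^ k" and q: "prime q"
  shows "card (torsion G (carrier G) q) \<le> q ^ k"
proof (cases "q = p")
  case True
  have "torsion G (carrier G) p = carrier G" using exponent by (auto simp: torsion_def)
  then show ?thesis using True card by simp
next
  case False
  then have "torsion G (carrier G) q \<subseteq> {\<one>}"
    using eq_one_if_coprime_powers[of _ p q] exponent primes_coprime[OF p q] by (auto simp: torsion_def)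
  then have "card (torsion G (carrier G) q) \<le> card {\<one>}" by (intro card_mono) auto
  also have "\<dots> \<le> q ^ k" using prime_gt_0_nat[OF q] by simp
  finally show ?thesis .
qed

text \<open>
  Here the whole group is its own \<open>p\<close>-torsion and the torsion for every other prime is trivial, so the upper and the
  lower bound coincide.
\<close>

lemma (in comm_group) rdim_prime_exponent:
  assumes fin: "finite (carrier G)" and p: "prime p" and exponent: "\<And>x. x \<in> carrier G \<Longrightarrow> x [^] p = \<one>"
    and card: "card (carrier G) = p ^ k"
  shows "rdim G = k"
proof (rule antisym)
  show "rdim G \<le> k"
    using card_torsion_le_of_prime_exponent[OF assms] by (rule rdim_le[OF fin])
  have "torsion G (carrier G) p = carrier G" using exponent by (auto simp: torsion_def)
  then have "p ^ k \<le> p ^ rdim G"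
    using card_torsion_le_rdim[OF fin prime_gt_0_nat[OF p]] card by simp
  then show "k \<le> rdim G" using prime_gt_1_nat[OF p] by simp
qed

lemma nat_pow_product_group_nth:
  assumes "i \<in> I"
  shows "(y [^]\<^bsub>product_group I G\<^esub> (k::nat)) i = y i [^]\<^bsub>G i\<^esub> k"
  using assms by (induction k) auto

text \<open>
  No basis has to be chosen: \<open>n\<close> separating characters embed \<open>G\<close> into the \<open>n\<close>-th power of the group of \<open>p\<close>-th roots of
  unity, and the embedding is onto because both sides have \<open>p ^ n\<close> elements. The map \<open>L\<close> in the proof is the
  discrete logarithm, which identifies the \<open>p\<close>-th roots of unity with the integers modulo \<open>p\<close>.
\<close>

lemma (in comm_group) elementary_abelian_if_prime_exponent:
  assumes fin: "finite (carrier G)" and p: "prime p" and exponent: "\<And>x. x \<in> carrier G \<Longrightarrow> x [^] p = \<one>"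
    and card: "card (carrier G) = p ^ n"
  shows "elementary_abelian G p n"
proof -
  let ?P = "product_group {..<n} (\<lambda>_. integer_mod_group p)"
  define \<zeta> where "\<zeta> = cis (2 * pi / real p)"
  have p0: "0 < p" using p by (rule prime_gt_0_nat)
  have bij: "bij_betw (\<lambda>k. \<zeta> ^ k) {..<p} {z. z ^ p = 1}"
    unfolding \<zeta>_def using p0 by (rule bij_betw_powers_roots_unity)
  have \<zeta>: "\<zeta> ^ p = 1" using p0 by (simp add: \<zeta>_def DeMoivre)
  define L where "L = inv_into {..<p} (\<lambda>k. \<zeta> ^ k)"
  have L: "L z < p" "\<zeta> ^ L z = z" if "z ^ p = 1" for z
  proof -
    have z: "z \<in> (\<lambda>k. \<zeta> ^ k) ` {..<p}" using that bij by (simp add: bij_betw_def)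
    show "L z < p" using inv_into_into[OF z] by (simp add: L_def)
    show "\<zeta> ^ L z = z" using f_inv_into_f[OF z] by (simp add: L_def)
  qed
  have L_mult: "L (z * w) = (L z + L w) mod p" if "z ^ p = 1" "w ^ p = 1" for z w
  proof -
    have zw: "(z * w) ^ p = 1" using that by (simp add: power_mult_distrib)
    have "\<zeta> ^ ((L z + L w) mod p) = \<zeta> ^ L (z * w)"
      using that L(2) zw by (simp add: power_mod_eq_if_power_eq_1[OF \<zeta>] power_add)
    then show ?thesis
      using bij L(1)[OF zw] p0 inj_onD[of "\<lambda>k. \<zeta> ^ k" "{..<p}" "(L z + L w) mod p" "L (z * w)"]
      by (simp add: bij_betw_def)
  qed
  obtain X where X: "\<And>i. i < n \<Longrightarrow> character G (carrier G) (X i)"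
    and sep: "\<And>x y. x \<in> carrier G \<Longrightarrow> y \<in> carrier G \<Longrightarrow> \<forall>i<n. X i x = X i y \<Longrightarrow> x = y"
    using ex_separating_characters[OF fin card_torsion_le_of_prime_exponent[OF fin p exponent card]] by blast
  have Xp: "X i x ^ p = 1" if "i < n" "x \<in> carrier G" for i x
    using character_pow[OF subgroup_self X[OF that(1)] that(2), of p] exponent[OF that(2)]
      character_one[OF X[OF that(1)]] by simp
  define h where "h x = (\<lambda>i\<in>{..<n}. int (L (X i x)))" for x
  have hom: "h \<in> hom G ?P"
  proof (rule homI)
    fix x assume x: "x \<in> carrier G"
    have "int (L (X i x)) \<in> carrier (integer_mod_group p)" if "i < n" for i
      using L(1)[OF Xp[OF that x]] by (simp add: carrier_integer_mod_group)
    then show "h x \<in> carrier ?P" by (simp add: h_def)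
    fix y assume y: "y \<in> carrier G"
    have "int (L (X i (x \<otimes> y))) = (int (L (X i x)) + int (L (X i y))) mod int p" if "i < n" for i
      using L_mult[OF Xp[OF that x] Xp[OF that y]] character_mult[OF X[OF that] x y]
      by (simp add: zmod_int)
    then show "h (x \<otimes> y) = h x \<otimes>\<^bsub>?P\<^esub> h y" by (simp add: h_def fun_eq_iff)
  qed
  have inj: "inj_on h (carrier G)"
  proof (rule inj_onI)
    fix x y assume xy: "x \<in> carrier G" "y \<in> carrier G" "h x = h y"
    show "x = y"
    proof (rule sep[OF xy(1,2)], intro allI impI)
      fix i assume i: "i < n"
      have "X i x = \<zeta> ^ L (X i x)" using L(2)[OF Xp[OF i xy(1)]] by (rule sym)
      also have "L (X i x) = L (X i y)" using fun_cong[OF xy(3), of i] i by (simp add: h_def)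
      also have "\<zeta> ^ L (X i y) = X i y" using L(2)[OF Xp[OF i xy(2)]] .
      finally show "X i x = X i y" .
    qed
  qed
  have "h ` carrier G = carrier ?P"
  proof (rule card_subset_eq)
    show "finite (carrier ?P)"
      using p0 by (simp add: finite_PiE carrier_integer_mod_group)
    show "h ` carrier G \<subseteq> carrier ?P" using hom by (rule hom_carrier)
    show "card (h ` carrier G) = card (carrier ?P)"
      using inj card p0 by (simp add: card_image card_PiE carrier_integer_mod_group)
  qed
  then have "h \<in> iso G ?P" using hom inj by (simp add: iso_def bij_betw_def)
  then show ?thesis unfolding elementary_abelian_def by (rule is_isoI)
qed

lemma (in group) elementary_abelianD:
  assumes p: "prime p" and G: "elementary_abelian G p n"
  shows "card (carrier G) = p ^ n" "x \<in> carrier G \<Longrightarrow> x [^] p = \<one>"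
proof -
  let ?P = "product_group {..<n} (\<lambda>_. integer_mod_group p)"
  obtain h where h: "h \<in> iso G ?P"
    using G unfolding elementary_abelian_def is_iso_def by blast
  then have inj: "inj_on h (carrier G)" and hom: "h \<in> hom G ?P"
    by (simp_all add: iso_def bij_betw_def)
  have p0: "0 < p" using p by (rule prime_gt_0_nat)
  have "card (carrier G) = card (carrier ?P)" using is_isoI[OF h] by (rule iso_same_card)
  then show "card (carrier G) = p ^ n" using p0 by (simp add: card_PiE carrier_integer_mod_group)
  have P: "group ?P" by (rule product_group) simp
  interpret h: group_hom G ?P h
    using hom P by (intro group_hom.intro group_hom_axioms.intro group_axioms)
  assume x: "x \<in> carrier G"
  have hx: "h x \<in> carrier ?P" using x by (rule h.hom_closed)
  have "h (x [^] p) = h x [^]\<^bsub>?P\<^esub> p" using h.hom_nat_pow[OF x] .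
  also have "\<dots> = \<one>\<^bsub>?P\<^esub>"
  proof (rule PiE_ext)
    show "h x [^]\<^bsub>?P\<^esub> p \<in> (\<Pi>\<^sub>E i\<in>{..<n}. carrier (integer_mod_group p))"
      using monoid.nat_pow_closed[OF group.is_monoid[OF P] hx, of p]
      by (simp only: carrier_product_group)
    show "(h x [^]\<^bsub>?P\<^esub> p) i = \<one>\<^bsub>?P\<^esub> i" if "i \<in> {..<n}" for i
      using that by (simp add: nat_pow_product_group_nth)
    show "\<one>\<^bsub>?P\<^esub> \<in> (\<Pi>\<^sub>E i\<in>{..<n}. carrier (integer_mod_group p))"
      using monoid.one_closed[OF group.is_monoid[OF P]] by (simp only: carrier_product_group)
  qed
  also have "\<dots> = h \<one>" by (simp only: h.hom_one)
  finally show "x [^] p = \<one>"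
    using inj_onD[OF inj] x by simp
qed

lemma (in group) torsion_restrict:
  "torsion (G\<lparr>carrier := H\<rparr>) K p = torsion G K p"
  by (simp add: torsion_def flip: nat_pow_consistent)

lemma (in comm_group) subgroup_imp_comm_group:
  assumes "subgroup H G"
  shows "comm_group (G\<lparr>carrier := H\<rparr>)"
proof -
  interpret H: group "G\<lparr>carrier := H\<rparr>" using assms by (rule subgroup_imp_group)
  show ?thesis
    by (rule H.group_comm_groupI) (use subgroup.mem_carrier[OF assms] m_comm in auto)
qed

text \<open>
  If the representation dimension \<open>n\<close> is positive, the bounds single out a prime \<open>p\<close> for which the
  \<open>p\<close>-torsion has more than \<open>p ^ (n - 1)\<close> elements. That subgroup already has representation dimension at least \<open>n\<close>,
  so by minimality it is all of \<open>G\<close>.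
\<close>

lemma (in comm_group) minimally_faithful_imp_elementary_abelian:
  assumes fin: "finite (carrier G)" and G: "minimally_faithful G n"
  obtains p where "prime p" "elementary_abelian G p n"
proof -
  from G have n: "rdim G = n"
    and minimal: "\<And>H. subgroup H G \<Longrightarrow> H \<subset> carrier G \<Longrightarrow> rdim (G\<lparr>carrier := H\<rparr>) < n"
    by (auto simp: minimally_faithful_def)
  show thesis
  proof (cases n)
    case 0
    have "card (torsion G (carrier G) p) \<le> 1" if "prime p" for p
      using card_torsion_le_rdim[OF fin prime_gt_0_nat[OF that]] n 0 by simp
    then have "carrier G = {\<one>}" by (rule trivial_if_no_torsion[OF subgroup_self fin])
    \<comment> \<open>The trivial group is elementary abelian of rank \<open>0\<close> for every prime; \<open>2\<close> serves as a witness.\<close>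
    then have "elementary_abelian G 2 0"
      using fin two_is_prime_nat by (intro elementary_abelian_if_prime_exponent) simp_all
    then show thesis using 0 two_is_prime_nat that by blast
  next
    case (Suc m)
    obtain p where p: "prime p" "p ^ m < card (torsion G (carrier G) p)"
    proof -
      have "\<not> rdim G \<le> m" using n Suc by simp
      then show thesis using rdim_le[OF fin, of m] that by (meson not_le)
    qed
    let ?T = "torsion G (carrier G) p"
    have T: "subgroup ?T G" by (rule torsion_subgroup[OF subgroup_self])
    interpret T: comm_group "G\<lparr>carrier := ?T\<rparr>" by (rule subgroup_imp_comm_group[OF T])
    have "torsion G ?T p = ?T" "finite ?T" using fin by (auto simp: torsion_def)
    then have "card ?T \<le> p ^ rdim (G\<lparr>carrier := ?T\<rparr>)"
      using T.card_torsion_le_rdim[of p] prime_gt_0_nat[OF p(1)] by (simp add: torsion_restrict)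
    then have "p ^ m < p ^ rdim (G\<lparr>carrier := ?T\<rparr>)" using p(2) by simp
    then have "n \<le> rdim (G\<lparr>carrier := ?T\<rparr>)"
      using prime_gt_1_nat[OF p(1)] Suc by simp
    then have "\<not> ?T \<subset> carrier G" using minimal[OF T] by (meson not_le)
    then have "carrier G \<subseteq> ?T" using subgroup.subset[OF T] by blast
    then have exponent: "x [^] p = \<one>" if "x \<in> carrier G" for x
      using that unfolding torsion_def by blast
    obtain k where k: "card (carrier G) = p ^ k"
      using card_prime_exponent[OF fin p(1) exponent] .
    then have "k = n" using rdim_prime_exponent[OF fin p(1) exponent k] n by simp
    with k have "elementary_abelian G p n"
      using elementary_abelian_if_prime_exponent[OF fin p(1) exponent] by blast
    with p(1) show thesis by (rule that)
  qed
qed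

text \<open>
  A proper subgroup again has exponent dividing \<open>p\<close>, and strictly fewer elements, so its order is a smaller power of \<open>p\<close>.
\<close>

lemma (in comm_group) elementary_abelian_imp_minimally_faithful:
  assumes fin: "finite (carrier G)" and p: "prime p" and G: "elementary_abelian G p n"
  shows "minimally_faithful G n"
  unfolding minimally_faithful_def
proof (intro conjI allI impI)
  note card = elementary_abelianD(1)[OF p G] and exponent = elementary_abelianD(2)[OF p G]
  show "rdim G = n" by (rule rdim_prime_exponent[OF fin p exponent card])
  fix H assume "subgroup H G \<and> H \<subset> carrier G"
  then have H: "subgroup H G" "H \<subset> carrier G" by auto
  interpret H: comm_group "G\<lparr>carrier := H\<rparr>" using H(1) by (rule subgroup_imp_comm_group)
  have finH: "finite H" using H(2) fin by (meson finite_subset psubset_imp_subset)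
  have carrier: "finite (carrier (G\<lparr>carrier := H\<rparr>))" using finH by simp
  have expH: "x [^]\<^bsub>G\<lparr>carrier := H\<rparr>\<^esub> p = \<one>\<^bsub>G\<lparr>carrier := H\<rparr>\<^esub>"
    if "x \<in> carrier (G\<lparr>carrier := H\<rparr>)" for x
  proof -
    have "x \<in> carrier G" using that H(2) by auto
    then show ?thesis using exponent by (simp flip: nat_pow_consistent)
  qed
  obtain k where "card (carrier (G\<lparr>carrier := H\<rparr>)) = p ^ k"
    by (rule H.card_prime_exponent[OF carrier p expH])
  then have k: "card H = p ^ k" by simp
  have "rdim (G\<lparr>carrier := H\<rparr>) = k"
    by (rule H.rdim_prime_exponent[OF carrier p expH]) (simp_all add: k)
  moreover have "p ^ k < p ^ n"
    using psubset_card_mono[OF fin H(2)] k card by simp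
  then have "k < n" using prime_gt_1_nat[OF p] by simp
  ultimately show "rdim (G\<lparr>carrier := H\<rparr>) < n" by simp
qed

theorem lemma2p2:
  fixes G :: "('a, 'b) monoid_scheme" and n :: nat
  assumes "comm_group G" and "finite (carrier G)"
  shows "minimally_faithful G n \<longleftrightarrow> (\<exists>p. prime p \<and> elementary_abelian G p n)"
proof
  assume "minimally_faithful G n"
  then show "\<exists>p. prime p \<and> elementary_abelian G p n"
    by (rule comm_group.minimally_faithful_imp_elementary_abelian[OF assms]) (intro exI conjI)
next
  assume "\<exists>p. prime p \<and> elementary_abelian G p n"
  then show "minimally_faithful G n"
    by (elim exE conjE) (rule comm_group.elementary_abelian_imp_minimally_faithful[OF assms])
qed

end
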